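(* A surjective quandle homomorphism $f\colon A\to B$ belongs to the class $\mathcal{M}$ (that is, the naturality square formed by $f$, $\eta_A\colon A\to\pi_0(A)$, $\eta_B\colon B\to\pi_0(B)$ and $\pi_0(f)\colon\pi_0(A)\to\pi_0(B)$, with $\eta_B\circ f=\pi_0(f)\circ\eta_A$, is a pullback) if and only if $\mathrm{Eq}(f)\cap\sim_{\mathrm{Inn}(A)}\ =\ \Delta_A$.
   Context: A quandle is a set $A$ with two binary operations $\lhd,\lhd^{-1}$ such that for all $a,b,c\in A$: (A1) $a\lhd a=a=a\lhd^{-1}a$; (A2) $(a\lhd b)\lhd^{-1}b=a=(a\lhd^{-1}b)\lhd b$; (A3) $(a\lhd b)\lhd c=(a\lhd c)\lhd(b\lhd c)$ and $(a\lhd^{-1}b)\lhd^{-1}c=(a\lhd^{-1}c)\lhd^{-1}(b\lhd^{-1}c)$. Quandle homomorphisms are maps preserving both operations. For $b\in A$, the map $\rho_b\colon A\to A$, $\rho_b(a)=a\lhd b$, is an automorphism of $A$; $\mathrm{Inn}(A)$ is the subgroup of the automorphism group of $A$ generated by all $\rho_b$, $b\in A$. Write $a\sim_{\mathrm{Inn}(A)}b$ when $a$ and $b$ lie in the same $\mathrm{Inn}(A)$-orbit; the orbits are the connected components of $A$. $\pi_0(A)$ is the set of connected components of $A$, viewed as a trivial quandle (one with $a\lhd b=a$ for all $a,b$); $\eta_A\colon A\to\pi_0(A)$ is the canonical projection, and $\pi_0(f)$ sends the component of $a$ to the component of $f(a)$. $\mathrm{Eq}(f)=\{(a,a')\in A\times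 A\mid f(a)=f(a')\}$ and $\Delta_A=\{(a,a)\mid a\in A\}$. The class $\mathcal{M}$ consists of the surjective quandle homomorphisms $f\colon A\to B$ for which the commutative square $\eta_B\circ f=\pi_0(f)\circ\eta_A$ is a pullback in the category of quandles. *)

theory Defs
  imports "HOL-Algebra.Bij" "HOL-Algebra.Group_Action" "HOL-Algebra.Generated_Groups"
begin

record 'a quandle = "'a partial_object" +
  rop  :: "'a \<Rightarrow> 'a \<Rightarrow> 'a" (infixl "\<triangleleft>\<index>" 70)
  rinv :: "'a \<Rightarrow> 'a \<Rightarrow> 'a" (infixl "\<triangleleft>\<inverse>\<index>" 70)

locale quandle =
  fixes A :: "'a quandle" (structure)
  assumes rop_closed: "\<lbrakk>a \<in> carrier A; b \<in> carrier A\<rbrakk> \<Longrightarrow> a \<triangleleft> b \<in> carrier A"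
    and rinv_closed: "\<lbrakk>a \<in> carrier A; b \<in> carrier A\<rbrakk> \<Longrightarrow> a \<triangleleft>\<inverse> b \<in> carrier A"
    and rop_idem: "a \<in> carrier A \<Longrightarrow> a \<triangleleft> a = a"
    and rinv_idem: "a \<in> carrier A \<Longrightarrow> a \<triangleleft>\<inverse> a = a"
    and rinv_rop: "\<lbrakk>a \<in> carrier A; b \<in> carrier A\<rbrakk> \<Longrightarrow> (a \<triangleleft> b) \<triangleleft>\<inverse> b = a"
    and rop_rinv: "\<lbrakk>a \<in> carrier A; b \<in> carrier A\<rbrakk> \<Longrightarrow> (a \<triangleleft>\<inverse> b) \<triangleleft> b = a"
    and rop_distrib: "\<lbrakk>a \<in> carrier A; b \<in> carrier A; c \<in> carrier A\<rbrakk>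
      \<Longrightarrow> (a \<triangleleft> b) \<triangleleft> c = (a \<triangleleft> c) \<triangleleft> (b \<triangleleft> c)"
    and rinv_distrib: "\<lbrakk>a \<in> carrier A; b \<in> carrier A; c \<in> carrier A\<rbrakk>
      \<Longrightarrow> (a \<triangleleft>\<inverse> b) \<triangleleft>\<inverse> c = (a \<triangleleft>\<inverse> c) \<triangleleft>\<inverse> (b \<triangleleft>\<inverse> c)"

definition qhom :: "'a quandle \<Rightarrow> 'b quandle \<Rightarrow> ('a \<Rightarrow> 'b) set" where
  "qhom A B = {f \<in> carrier A \<rightarrow> carrier B. \<forall>a\<in>carrier A. \<forall>b\<in>carrier A.
     f (a \<triangleleft>\<^bsub>A\<^esub> b) = f a \<triangleleft>\<^bsub>B\<^esub> f b \<and>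
     f (a \<triangleleft>\<inverse>\<^bsub>A\<^esub> b) = f a \<triangleleft>\<inverse>\<^bsub>B\<^esub> f b}"

definition rho :: "'a quandle \<Rightarrow> 'a \<Rightarrow> 'a \<Rightarrow> 'a" where
  "rho A b = (\<lambda>a\<in>carrier A. a \<triangleleft>\<^bsub>A\<^esub> b)"

definition QAutoGroup :: "'a quandle \<Rightarrow> ('a \<Rightarrow> 'a) monoid" where
  "QAutoGroup A = BijGroup (carrier A) \<lparr>carrier := qhom A A \<inter> Bij (carrier A)\<rparr>"

definition Inn :: "'a quandle \<Rightarrow> ('a \<Rightarrow> 'a) monoid" where
  "Inn A = QAutoGroup A \<lparr>carrier := generate (QAutoGroup A) (rho A ` carrier A)\<rparr>"

text \<open>
  \<open>component A\<close> is the projection \<open>\<eta>\<^sub>A\<close> onto \<open>pi0 A\<close>.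
  The elements of \<open>Inn A\<close> are themselves functions, so the action is \<open>\<lambda>g. g\<close>.
\<close>

definition component :: "'a quandle \<Rightarrow> 'a \<Rightarrow> 'a set" where
  "component A a = orbit (Inn A) (\<lambda>g. g) a"

definition components :: "'a quandle \<Rightarrow> 'a set set" where
  "components A = orbits (Inn A) (carrier A) (\<lambda>g. g)"

definition inn_rel :: "'a quandle \<Rightarrow> ('a \<times> 'a) set" where
  "inn_rel A = {(a, b) \<in> carrier A \<times> carrier A. \<exists>C\<in>components A. a \<in> C \<and> b \<in> C}"

definition pi0 :: "'a quandle \<Rightarrow> 'a set quandle" where
  "pi0 A = \<lparr>carrier = components A, rop = (\<lambda>C D. C), rinv = (\<lambda>C D. C)\<rparr>"

text \<open>On a component of \<open>A\<close> and for a homomorphism \<open>f\<close>, the component of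
  \<open>f a\<close> does not depend on the choice of \<open>a \<in> C\<close>, so the description is unique.\<close>

definition pi0_map :: "'a quandle \<Rightarrow> 'b quandle \<Rightarrow> ('a \<Rightarrow> 'b) \<Rightarrow> 'a set \<Rightarrow> 'b set" where
  "pi0_map A B f C = (THE D. \<exists>a\<in>C. D = component B (f a))"

definition Eq :: "'a quandle \<Rightarrow> ('a \<Rightarrow> 'b) \<Rightarrow> ('a \<times> 'a) set" where
  "Eq A f = {(a, a') \<in> carrier A \<times> carrier A. f a = f a'}"

text \<open>
  \<open>is_pullback TYPE('x) P p q B C D g h\<close>: the square with legs \<open>p : P \<rightarrow> B\<close>, \<open>q : P \<rightarrow> C\<close>
  over \<open>g : B \<rightarrow> D\<close>, \<open>h : C \<rightarrow> D\<close> commutes and is universal among the cones whose apex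
  is a quandle with elements in \<open>'x\<close>. HOL cannot quantify over types inside a formula, so
  the type of the apexes is a parameter; the pullback property in the category of all
  quandles is \<open>is_pullback TYPE('x)\<close> for every \<open>'x\<close>.
  Extensionality makes equality of functions coincide with equality of morphisms.
\<close>

definition is_pullback :: "'x itself \<Rightarrow> 'p quandle \<Rightarrow> ('p \<Rightarrow> 'b) \<Rightarrow> ('p \<Rightarrow> 'c) \<Rightarrow>
    'b quandle \<Rightarrow> 'c quandle \<Rightarrow> 'd quandle \<Rightarrow> ('b \<Rightarrow> 'd) \<Rightarrow> ('c \<Rightarrow> 'd) \<Rightarrow> bool" where
  "is_pullback T P p q B C D g h \<longleftrightarrow>
     quandle P \<and> quandle B \<and> quandle C \<and> quandle D \<and>
     p \<in> qhom P B \<and> q \<in> qhom P C \<and> g \<in> qhom B D \<and> h \<in> qhom C D \<and>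
     (\<forall>x\<in>carrier P. g (p x) = h (q x)) \<and>
     (\<forall>(X :: 'x quandle) u v.
        quandle X \<and> u \<in> qhom X B \<and> v \<in> qhom X C \<and>
        (\<forall>x\<in>carrier X. g (u x) = h (v x)) \<longrightarrow>
        (\<exists>!w. w \<in> qhom X P \<inter> extensional (carrier X) \<and>
              (\<forall>x\<in>carrier X. p (w x) = u x \<and> q (w x) = v x)))"

definition class_M :: "'x itself \<Rightarrow> 'a quandle \<Rightarrow> 'b quandle \<Rightarrow> ('a \<Rightarrow> 'b) \<Rightarrow> bool" where
  "class_M T A B f \<longleftrightarrow>
     quandle A \<and> quandle B \<and> f \<in> qhom A B \<and> f ` carrier A = carrier B \<and>
     is_pullback T A f (component A) B (pi0 A) (pi0 B) (component B) (pi0_map A B f)"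

end

theory Submission
  imports Defs
begin

text \<open>
  The component of \<open>a\<close> consists of the endpoints of the paths \<open>a \<triangleleft>\<^sup>\<plusminus>\<^sup>1 c\<^sub>1 \<triangleleft>\<^sup>\<plusminus>\<^sup>1 \<dots> \<triangleleft>\<^sup>\<plusminus>\<^sup>1 c\<^sub>n\<close>.
  Paths lift along a surjective homomorphism, so every pair of a point \<open>b\<close> and a component
  \<open>C\<close> with the same image in \<open>pi0 B\<close> comes from some \<open>a \<in> C\<close> with \<open>f a = b\<close>. Such an \<open>a\<close>
  is unique precisely when \<open>f\<close> is injective on each component, which is the condition on
  \<open>Eq A f\<close>. Conversely, cones with a one-element apex detect this uniqueness.
\<close>

section \<open>Right translations as automorphisms, and their inverses\<close>

context quandle
begin

text \<open>The axioms distribute each operation only over itself; the mixed laws make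
  \<open>rho A c\<close> and its inverse preserve both operations. Distributing \<open>c\<close>
  over \<open>(a \<triangleleft>\<inverse> b) \<triangleleft> b = a\<close> and then cancelling
  \<open>b \<triangleleft> c\<close> gives this one.\<close>

lemma rinv_rop_distrib:
  assumes "a \<in> carrier A" "b \<in> carrier A" "c \<in> carrier A"
  shows "(a \<triangleleft>\<inverse> b) \<triangleleft> c = (a \<triangleleft> c) \<triangleleft>\<inverse> (b \<triangleleft> c)"
  using rop_distrib[of "a \<triangleleft>\<inverse> b" b c] rinv_rop[of "(a \<triangleleft>\<inverse> b) \<triangleleft> c" "b \<triangleleft> c"] assms
  by (simp add: rop_closed rinv_closed rop_rinv)

lemma rop_rinv_distrib:
  assumes "a \<in> carrier A" "b \<in> carrier A" "c \<in> carrier A"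
  shows "(a \<triangleleft> b) \<triangleleft>\<inverse> c = (a \<triangleleft>\<inverse> c) \<triangleleft> (b \<triangleleft>\<inverse> c)"
  using rinv_distrib[of "a \<triangleleft> b" b c] rop_rinv[of "(a \<triangleleft> b) \<triangleleft>\<inverse> c" "b \<triangleleft>\<inverse> c"] assms
  by (simp add: rop_closed rinv_closed rinv_rop)

lemma rho_mem:
  assumes "c \<in> carrier A"
  shows "rho A c \<in> qhom A A \<inter> Bij (carrier A)"
proof
  show "rho A c \<in> qhom A A"
    unfolding qhom_def rho_def
    using assms rop_distrib[OF _ _ assms] rinv_rop_distrib[OF _ _ assms]
    by (simp add: rop_closed rinv_closed)
  have "bij_betw (rho A c) (carrier A) (carrier A)"
    using assms by (intro bij_betwI[where g = "\<lambda>a. a \<triangleleft>\<inverse> c"])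
      (auto simp: rho_def rop_closed rinv_closed rinv_rop rop_rinv)
  then show "rho A c \<in> Bij (carrier A)"
    by (simp add: Bij_def rho_def)
qed

lemma rho_inverse_mem:
  assumes "c \<in> carrier A"
  shows "(\<lambda>a\<in>carrier A. a \<triangleleft>\<inverse> c) \<in> qhom A A \<inter> Bij (carrier A)"
proof
  show "(\<lambda>a\<in>carrier A. a \<triangleleft>\<inverse> c) \<in> qhom A A"
    unfolding qhom_def
    using assms rinv_distrib[OF _ _ assms] rop_rinv_distrib[OF _ _ assms]
    by (simp add: rop_closed rinv_closed)
  have "bij_betw (\<lambda>a\<in>carrier A. a \<triangleleft>\<inverse> c) (carrier A) (carrier A)"
    using assms by (intro bij_betwI[where g = "\<lambda>a. a \<triangleleft> c"])
      (auto simp: rop_closed rinv_closed rinv_rop rop_rinv)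
  then show "(\<lambda>a\<in>carrier A. a \<triangleleft>\<inverse> c) \<in> Bij (carrier A)"
    by (simp add: Bij_def)
qed

lemma mult_QAutoGroup:
  assumes "g \<in> carrier (QAutoGroup A)" "h \<in> carrier (QAutoGroup A)"
  shows "g \<otimes>\<^bsub>QAutoGroup A\<^esub> h = compose (carrier A) g h"
  using assms by (simp add: QAutoGroup_def BijGroup_def)

lemma one_QAutoGroup: "\<one>\<^bsub>QAutoGroup A\<^esub> = (\<lambda>a\<in>carrier A. a)"
  by (simp add: QAutoGroup_def BijGroup_def)

text \<open>A monoid structure suffices for what follows: the only inverses taken in
  \<open>generate\<close> are those of the generators \<open>rho A c\<close>, and these are
  exhibited explicitly.\<close>

lemma monoid_QAutoGroup: "monoid (QAutoGroup A)"
proof -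
  have "submonoid (qhom A A \<inter> Bij (carrier A)) (BijGroup (carrier A))"
  proof
    fix g h
    assume "g \<in> qhom A A \<inter> Bij (carrier A)" "h \<in> qhom A A \<inter> Bij (carrier A)"
    then show "g \<otimes>\<^bsub>BijGroup (carrier A)\<^esub> h \<in> qhom A A \<inter> Bij (carrier A)"
      using compose_Bij[of g "carrier A" h]
      by (auto simp: BijGroup_def qhom_def compose_def rop_closed rinv_closed Pi_iff)
  next
    show "\<one>\<^bsub>BijGroup (carrier A)\<^esub> \<in> qhom A A \<inter> Bij (carrier A)"
      by (auto simp: BijGroup_def id_Bij qhom_def rop_closed rinv_closed)
  qed (simp add: BijGroup_def)
  moreover have "monoid (BijGroup (carrier A))"
    by (simp add: group_BijGroup group.is_monoid)
  ultimately show ?thesis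
    unfolding QAutoGroup_def by (rule submonoid.submonoid_is_monoid)
qed

lemma inv_rho:
  assumes c: "c \<in> carrier A"
  shows "inv\<^bsub>QAutoGroup A\<^esub> (rho A c) = (\<lambda>a\<in>carrier A. a \<triangleleft>\<inverse> c)"
proof -
  let ?r = "\<lambda>a\<in>carrier A. a \<triangleleft>\<inverse> c"
  have mem: "rho A c \<in> carrier (QAutoGroup A)" "?r \<in> carrier (QAutoGroup A)"
    using rho_mem[OF c] rho_inverse_mem[OF c] by (simp_all add: QAutoGroup_def)
  have "rho A c \<otimes>\<^bsub>QAutoGroup A\<^esub> ?r = \<one>\<^bsub>QAutoGroup A\<^esub>"
    "?r \<otimes>\<^bsub>QAutoGroup A\<^esub> rho A c = \<one>\<^bsub>QAutoGroup A\<^esub>"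
    unfolding mult_QAutoGroup[OF mem] mult_QAutoGroup[OF mem(2,1)] one_QAutoGroup
    using c by (auto simp: compose_def rho_def rop_closed rinv_closed rinv_rop rop_rinv)
  then show ?thesis
    using monoid.inv_unique'[OF monoid_QAutoGroup mem] by simp
qed

end

section \<open>Components as sets of endpoints of paths\<close>

text \<open>Steps are appended at the end of a path, which matches left multiplication of a group
  element by a generator or its inverse.\<close>

inductive connected :: "'a quandle \<Rightarrow> 'a \<Rightarrow> 'a \<Rightarrow> bool" for A where
  refl: "a \<in> carrier A \<Longrightarrow> connected A a a"
| rop: "connected A a b \<Longrightarrow> c \<in> carrier A \<Longrightarrow> connected A a (b \<triangleleft>\<^bsub>A\<^esub> c)"
| rinv: "connected A a b \<Longrightarrow> c \<in> carrier A \<Longrightarrow> connected A a (b \<triangleleft>\<inverse>\<^bsub>A\<^esub> c)"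

context quandle
begin

lemma connected_carrier: "connected A a b \<Longrightarrow> a \<in> carrier A \<and> b \<in> carrier A"
  by (induction rule: connected.induct) (auto simp: rop_closed rinv_closed)

text \<open>The second path comes first among the premises because it is the one that grows in the
  induction.\<close>

lemma connected_trans: "connected A b c \<Longrightarrow> connected A a b \<Longrightarrow> connected A a c"
  by (induction rule: connected.induct) (auto intro: connected.intros)

text \<open>By (A2) a step with \<open>c\<close> is undone by the opposite step with the same
  \<open>c\<close>; the reversed step is then prefixed to the reversed path.\<close>

lemma connected_sym: "connected A a b \<Longrightarrow> connected A b a"
proof (induction rule: connected.induct)
  case (rop a b c)
  then have b: "b \<in> carrier A" using connected_carrier by blast
  have "connected A (b \<triangleleft> c) ((b \<triangleleft> c) \<triangleleft>\<inverse> c)"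
    using b rop by (blast intro: connected.intros rop_closed)
  then have "connected A (b \<triangleleft> c) b"
    using b rop by (simp add: rinv_rop)
  with rop show ?case by (blast intro: connected_trans)
next
  case (rinv a b c)
  then have b: "b \<in> carrier A" using connected_carrier by blast
  have "connected A (b \<triangleleft>\<inverse> c) ((b \<triangleleft>\<inverse> c) \<triangleleft> c)"
    using b rinv by (blast intro: connected.intros rinv_closed)
  then have "connected A (b \<triangleleft>\<inverse> c) b"
    using b rinv by (simp add: rop_rinv)
  with rinv show ?case by (blast intro: connected_trans)
qed (rule connected.refl)

text \<open>Membership in the carrier is carried along in the induction because only there does the
  product unfold to \<open>compose\<close>.\<close>

lemma generate_rho_connected:
  assumes "g \<in> generate (QAutoGroup A) (rho A ` carrier A)"
  shows "g \<in> carrier (QAutoGroup A) \<and> (\<forall>a\<in>carrier A. connected A a (g a))"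
  using assms
proof (induction rule: generate.induct)
  case one
  then show ?case
    using monoid.one_closed[OF monoid_QAutoGroup]
    by (metis one_QAutoGroup restrict_apply' connected.refl)
next
  case (incl h)
  then show ?case
    using rho_mem by (auto simp: QAutoGroup_def, auto simp: rho_def
        intro: connected.rop[OF connected.refl])
next
  case (inv h)
  then obtain c where c: "c \<in> carrier A" "h = rho A c"
    by blast
  have "(\<lambda>a\<in>carrier A. a \<triangleleft>\<inverse> c) \<in> carrier (QAutoGroup A)"
    using rho_inverse_mem[OF c(1)] unfolding QAutoGroup_def by simp
  moreover have "\<forall>a\<in>carrier A. connected A a ((\<lambda>a\<in>carrier A. a \<triangleleft>\<inverse> c) a)"
    using c by (simp add: connected.intros)
  ultimately show ?case
    unfolding c(2) inv_rho[OF c(1)] ..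
next
  case (eng g h)
  then have mem: "g \<in> carrier (QAutoGroup A)" "h \<in> carrier (QAutoGroup A)"
    by auto
  \<comment> \<open>The path from \<open>a\<close> to \<open>h a\<close> is followed by the one from
    \<open>h a\<close> to \<open>g (h a)\<close>.\<close>
  have "connected A a (compose (carrier A) g h a)" if "a \<in> carrier A" for a
    using eng.IH that connected_carrier connected_trans by (metis compose_eq)
  moreover have "g \<otimes>\<^bsub>QAutoGroup A\<^esub> h \<in> carrier (QAutoGroup A)"
    using mem by (rule monoid.m_closed[OF monoid_QAutoGroup])
  ultimately show ?case
    unfolding mult_QAutoGroup[OF mem] by blast
qed

text \<open>Each further step of the path multiplies the group element found so far on the left by
  \<open>rho A c\<close> or by its inverse.\<close>

lemma connected_generate_rho:
  assumes "connected A a b"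
  shows "\<exists>g \<in> generate (QAutoGroup A) (rho A ` carrier A). b = g a"
  using assms
proof (induction rule: connected.induct)
  case (refl a)
  then show ?case
    by (intro bexI[OF _ generate.one]) (simp add: one_QAutoGroup)
next
  case (rop a b c)
  then obtain g where g: "g \<in> generate (QAutoGroup A) (rho A ` carrier A)" "b = g a"
    by blast
  have r: "rho A c \<in> generate (QAutoGroup A) (rho A ` carrier A)"
    using rop by (simp add: generate.incl)
  have "b \<triangleleft> c = (rho A c \<otimes>\<^bsub>QAutoGroup A\<^esub> g) a"
    using generate_rho_connected[OF g(1)] generate_rho_connected[OF r] g(2)
      connected_carrier[OF rop(1)]
    by (simp add: mult_QAutoGroup compose_def) (simp add: rho_def)
  with generate.eng[OF r g(1)] show ?case by blast
next
  case (rinv a b c)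
  then obtain g where g: "g \<in> generate (QAutoGroup A) (rho A ` carrier A)" "b = g a"
    by blast
  have r: "inv\<^bsub>QAutoGroup A\<^esub> (rho A c) \<in> generate (QAutoGroup A) (rho A ` carrier A)"
    using rinv by (simp add: generate.inv)
  have "b \<triangleleft>\<inverse> c = (inv\<^bsub>QAutoGroup A\<^esub> (rho A c) \<otimes>\<^bsub>QAutoGroup A\<^esub> g) a"
    using generate_rho_connected[OF g(1)] generate_rho_connected[OF r] g(2)
      connected_carrier[OF rinv(1)] rinv(2)
    by (simp add: mult_QAutoGroup compose_def) (simp add: inv_rho)
  with generate.eng[OF r g(1)] show ?case by blast
qed

text \<open>With this, orbits under the generated subgroup can be handled by induction on paths
  alone.\<close>

lemma component_eq_connected:
  assumes "a \<in> carrier A"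
  shows "component A a = {b. connected A a b}"
proof -
  have "component A a = {g a | g. g \<in> generate (QAutoGroup A) (rho A ` carrier A)}"
    by (simp add: component_def orbit_def Inn_def)
  also have "\<dots> = {b. connected A a b}"
  proof (intro equalityI subsetI)
    fix b
    assume "b \<in> {g a | g. g \<in> generate (QAutoGroup A) (rho A ` carrier A)}"
    then show "b \<in> {b. connected A a b}"
      using generate_rho_connected assms by auto
  next
    fix b
    assume "b \<in> {b. connected A a b}"
    then show "b \<in> {g a | g. g \<in> generate (QAutoGroup A) (rho A ` carrier A)}"
      using connected_generate_rho[of a b] by auto
  qed
  finally show ?thesis .
qed

lemma component_eq_iff:
  assumes "a \<in> carrier A" "b \<in> carrier A"
  shows "component A a = component A b \<longleftrightarrow> connected A a b"
proof
  assume "component A a = component A b"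
  then show "connected A a b"
    using connected.refl[OF assms(2)] assms by (auto simp: component_eq_connected)
next
  assume ab: "connected A a b"
  have "connected A a c \<longleftrightarrow> connected A b c" for c
    using connected_trans[OF _ ab] connected_trans[OF _ connected_sym[OF ab]] by iprover
  then show "component A a = component A b"
    using assms by (simp add: component_eq_connected)
qed

lemma component_mem_iff:
  assumes "a \<in> carrier A"
  shows "b \<in> component A a \<longleftrightarrow> b \<in> carrier A \<and> component A b = component A a"
proof
  assume "b \<in> component A a"
  then have "connected A a b"
    using assms by (simp add: component_eq_connected)
  then show "b \<in> carrier A \<and> component A b = component A a"
    using assms connected_carrier component_eq_iff by blast
next
  assume "b \<in> carrier A \<and> component A b = component A a"
  then have "connected A a b"
    using component_eq_iff[of a b] assms by simp
  then show "b \<in> component A a"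
    using assms by (simp add: component_eq_connected)
qed

section \<open>The trivial quandle of components and the projection onto it\<close>

lemma components_eq: "components A = component A ` carrier A"
  by (auto simp: components_def orbits_def component_def)

lemma inn_rel_iff:
  "(a, b) \<in> inn_rel A \<longleftrightarrow> a \<in> carrier A \<and> b \<in> carrier A \<and> component A a = component A b"
proof
  assume "(a, b) \<in> inn_rel A"
  then show "a \<in> carrier A \<and> b \<in> carrier A \<and> component A a = component A b"
    by (force simp: inn_rel_def components_eq component_mem_iff)
next
  assume ab: "a \<in> carrier A \<and> b \<in> carrier A \<and> component A a = component A b"
  then have "a \<in> component A a" "b \<in> component A a" "component A a \<in> components A"
    by (simp_all add: components_eq component_mem_iff)
  with ab show "(a, b) \<in> inn_rel A"
    unfolding inn_rel_def by blast
qed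

lemma quandle_pi0: "quandle (pi0 A)"
  by unfold_locales (auto simp: pi0_def)

text \<open>Both \<open>a \<triangleleft> b\<close> and \<open>a \<triangleleft>\<inverse> b\<close>
  are one step away from \<open>a\<close>, and the operations of \<open>pi0 A\<close> return their
  left argument.\<close>

lemma component_hom: "component A \<in> qhom A (pi0 A)"
proof -
  have "component A (a \<triangleleft> b) = component A a \<and> component A (a \<triangleleft>\<inverse> b) = component A a"
    if "a \<in> carrier A" "b \<in> carrier A" for a b
    using that component_eq_iff[of a "a \<triangleleft> b"] component_eq_iff[of a "a \<triangleleft>\<inverse> b"]
    by (simp add: rop_closed rinv_closed connected.rop connected.rinv connected.refl)
  then show ?thesis
    by (auto simp: qhom_def pi0_def components_eq)
qed

end

section \<open>Homomorphisms acting on paths and on components\<close>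

lemma qhom_closed: "f \<in> qhom A B \<Longrightarrow> a \<in> carrier A \<Longrightarrow> f a \<in> carrier B"
  by (auto simp: qhom_def)

lemma qhom_rop:
  "f \<in> qhom A B \<Longrightarrow> a \<in> carrier A \<Longrightarrow> b \<in> carrier A \<Longrightarrow>
    f (a \<triangleleft>\<^bsub>A\<^esub> b) = f a \<triangleleft>\<^bsub>B\<^esub> f b"
  by (simp add: qhom_def)

lemma qhom_rinv:
  "f \<in> qhom A B \<Longrightarrow> a \<in> carrier A \<Longrightarrow> b \<in> carrier A \<Longrightarrow>
    f (a \<triangleleft>\<inverse>\<^bsub>A\<^esub> b) = f a \<triangleleft>\<inverse>\<^bsub>B\<^esub> f b"
  by (simp add: qhom_def)

lemma qhom_connected:
  assumes "quandle A" "f \<in> qhom A B" "connected A a b"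
  shows "connected B (f a) (f b)"
  using assms(3)
proof (induction rule: connected.induct)
  case (refl a)
  then show ?case
    using assms by (auto intro: connected.refl qhom_closed)
next
  case (rop a b c)
  then show ?case
    using assms quandle.connected_carrier[of A a b]
    by (auto simp: qhom_rop intro: connected.rop qhom_closed)
next
  case (rinv a b c)
  then show ?case
    using assms quandle.connected_carrier[of A a b]
    by (auto simp: qhom_rinv intro: connected.rinv qhom_closed)
qed

text \<open>Surjectivity provides for every step with \<open>d\<close> in \<open>B\<close> some
  \<open>c\<close> over \<open>d\<close>, and a step with \<open>c\<close> continues the lifted
  path. The starting point \<open>a\<close> over \<open>b\<close> can be prescribed.\<close>

lemma connected_lift:
  assumes "quandle A" "f \<in> qhom A B" "f ` carrier A = carrier B"
    and "connected B b b'" "a \<in> carrier A" "f a = b"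
  shows "\<exists>a'. connected A a a' \<and> f a' = b'"
  using assms(4-6)
proof (induction rule: connected.induct)
  case (refl b)
  then show ?case by (auto intro: connected.refl)
next
  case (rop b b' d)
  then obtain a' where a': "connected A a a'" "f a' = b'"
    by blast
  obtain c where "c \<in> carrier A" "f c = d"
    using rop.hyps(2) unfolding assms(3)[symmetric] by blast
  then show ?case
    using a' assms quandle.connected_carrier[of A a a']
    by (intro exI[of _ "a' \<triangleleft>\<^bsub>A\<^esub> c"]) (auto simp: qhom_rop intro: connected.rop)
next
  case (rinv b b' d)
  then obtain a' where a': "connected A a a'" "f a' = b'"
    by blast
  obtain c where "c \<in> carrier A" "f c = d"
    using rinv.hyps(2) unfolding assms(3)[symmetric] by blast
  then show ?case
    using a' assms quandle.connected_carrier[of A a a']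
    by (intro exI[of _ "a' \<triangleleft>\<inverse>\<^bsub>A\<^esub> c"]) (auto simp: qhom_rinv intro: connected.rinv)
qed

text \<open>Paths are sent to paths, so all points of the component of \<open>a\<close> yield the
  same value and the description in \<open>pi0_map\<close> is well defined.\<close>

lemma pi0_map_component:
  assumes "quandle A" "quandle B" "f \<in> qhom A B" "a \<in> carrier A"
  shows "pi0_map A B f (component A a) = component B (f a)"
  unfolding pi0_map_def
proof (rule the_equality)
  show "\<exists>a'\<in>component A a. component B (f a) = component B (f a')"
    using assms by (auto simp: quandle.component_mem_iff)
next
  fix D
  assume "\<exists>a'\<in>component A a. D = component B (f a')"
  then obtain a' where "connected A a a'" "D = component B (f a')"
    using assms by (auto simp: quandle.component_eq_connected)
  then show "D = component B (f a)"
    using assms qhom_connected[OF assms(1,3), of a a'] quandle.connected_carrier[of A a a']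
    by (metis qhom_closed quandle.component_eq_iff)
qed

lemma pi0_map_hom:
  assumes "quandle A" "quandle B" "f \<in> qhom A B"
  shows "pi0_map A B f \<in> qhom (pi0 A) (pi0 B)"
  unfolding qhom_def[of "pi0 A"] using assms
  by (auto simp: pi0_def quandle.components_eq pi0_map_component qhom_closed)

text \<open>This is surjectivity of the comparison map from \<open>A\<close> to the fibre product of
  \<open>B\<close> and \<open>pi0 A\<close> over \<open>pi0 B\<close>: a path in \<open>B\<close>
  from \<open>f a\<close> to \<open>b\<close> is lifted to start at a representative
  \<open>a\<close> of \<open>C\<close>.\<close>

lemma component_lift:
  assumes "quandle A" "quandle B" "f \<in> qhom A B" "f ` carrier A = carrier B"
    and "b \<in> carrier B" "C \<in> components A" "component B b = pi0_map A B f C"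
  shows "\<exists>a\<in>carrier A. f a = b \<and> component A a = C"
proof -
  obtain a where a: "a \<in> carrier A" "C = component A a"
    using assms by (auto simp: quandle.components_eq)
  then have "connected B (f a) b"
    using assms by (metis pi0_map_component qhom_closed quandle.component_eq_iff)
  then obtain a' where "connected A a a'" "f a' = b"
    using connected_lift[OF assms(1,3,4)] a by blast
  then show ?thesis
    using a assms by (metis quandle.component_eq_iff quandle.connected_carrier)
qed

section \<open>Joint injectivity of the two legs, and one-point cones\<close>

lemma Eq_inter_inn_rel_iff:
  assumes "quandle A"
  shows "Eq A f \<inter> inn_rel A = Id_on (carrier A) \<longleftrightarrow>
    (\<forall>a\<in>carrier A. \<forall>a'\<in>carrier A. f a = f a' \<longrightarrow> component A a = component A a' \<longrightarrow> a = a')"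
proof
  assume E: "Eq A f \<inter> inn_rel A = Id_on (carrier A)"
  show "\<forall>a\<in>carrier A. \<forall>a'\<in>carrier A. f a = f a' \<longrightarrow> component A a = component A a' \<longrightarrow> a = a'"
  proof (intro ballI impI)
    fix a a'
    assume "a \<in> carrier A" "a' \<in> carrier A" "f a = f a'" "component A a = component A a'"
    then have "(a, a') \<in> Eq A f \<inter> inn_rel A"
      using assms by (simp add: Eq_def quandle.inn_rel_iff)
    then show "a = a'"
      unfolding E by auto
  qed
next
  assume "\<forall>a\<in>carrier A. \<forall>a'\<in>carrier A. f a = f a' \<longrightarrow> component A a = component A a' \<longrightarrow> a = a'"
  then show "Eq A f \<inter> inn_rel A = Id_on (carrier A)"
    using assms by (fastforce simp: Eq_def quandle.inn_rel_iff)
qed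

lemma quandle_singleton: "quandle \<lparr>carrier = {x}, rop = (\<lambda>a b. a), rinv = (\<lambda>a b. a)\<rparr>"
  by unfold_locales auto

text \<open>Idempotence (A1) makes every constant map a homomorphism, so points of \<open>A\<close>
  correspond to maps from a one-element quandle.\<close>

lemma qhom_singleton:
  assumes "quandle A" "a \<in> carrier A"
  shows "(\<lambda>y\<in>{x}. a) \<in> qhom \<lparr>carrier = {x}, rop = (\<lambda>a b. a), rinv = (\<lambda>a b. a)\<rparr> A"
  using assms by (simp add: qhom_def quandle.rop_idem quandle.rinv_idem)

lemma is_pullback_unique:
  fixes X :: "'x quandle"
  assumes "is_pullback TYPE('x) P p q B C D g h" and "quandle X"
    and "u \<in> qhom X B" "v \<in> qhom X C" "\<forall>x\<in>carrier X. g (u x) = h (v x)"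
    and "w \<in> qhom X P \<inter> extensional (carrier X)" "w' \<in> qhom X P \<inter> extensional (carrier X)"
    and "\<forall>x\<in>carrier X. p (w x) = u x \<and> q (w x) = v x"
      "\<forall>x\<in>carrier X. p (w' x) = u x \<and> q (w' x) = v x"
  shows "w = w'"
proof -
  have "\<exists>!w. w \<in> qhom X P \<inter> extensional (carrier X) \<and>
      (\<forall>x\<in>carrier X. p (w x) = u x \<and> q (w x) = v x)"
    using assms(1) unfolding is_pullback_def using assms(2-5) by blast
  then show ?thesis
    using assms(6-9) by blast
qed

text \<open>Two points with equal images under both legs, viewed as maps from a one-element quandle,
  mediate the same cone, so uniqueness identifies them.\<close>

lemma pullback_legs_jointly_injective:
  assumes pb: "is_pullback TYPE('x) P p q B C D g h"
    and a: "a \<in> carrier P" "a' \<in> carrier P" "p a = p a'" "q a = q a'"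
  shows "a = a'"
proof -
  \<comment> \<open>\<open>undefined\<close> merely names some element of \<open>'x\<close>; every
    type is inhabited, so a one-point apex is available for each choice of
    \<open>'x\<close>.\<close>
  define X :: "'x quandle" where
    "X = \<lparr>carrier = {undefined}, rop = (\<lambda>a b. a), rinv = (\<lambda>a b. a)\<rparr>"
  have carrier_X: "carrier X = {undefined}"
    by (simp add: X_def)
  have X: "quandle X"
    unfolding X_def by (rule quandle_singleton)
  have P: "quandle P" and B: "quandle B" and C: "quandle C"
    and p: "p \<in> qhom P B" and q: "q \<in> qhom P C"
    and sq: "\<forall>x\<in>carrier P. g (p x) = h (q x)"
    using pb by (auto simp: is_pullback_def)
  have "(\<lambda>y\<in>carrier X. a) = (\<lambda>y\<in>carrier X. a')"
  proof (rule is_pullback_unique[OF pb X])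
    show "(\<lambda>y\<in>carrier X. p a) \<in> qhom X B"
      using qhom_singleton[OF B qhom_closed[OF p a(1)]] by (simp add: X_def)
    show "(\<lambda>y\<in>carrier X. q a) \<in> qhom X C"
      using qhom_singleton[OF C qhom_closed[OF q a(1)]] by (simp add: X_def)
    show "(\<lambda>y\<in>carrier X. a) \<in> qhom X P \<inter> extensional (carrier X)"
      "(\<lambda>y\<in>carrier X. a') \<in> qhom X P \<inter> extensional (carrier X)"
      using qhom_singleton[OF P a(1)] qhom_singleton[OF P a(2)] by (auto simp: X_def)
  qed (use a sq in \<open>simp_all add: carrier_X\<close>)
  from fun_cong[OF this, of undefined] show ?thesis
    by (simp add: carrier_X)
qed

section \<open>The pullback property as injectivity of the surjection on each component\<close>

theorem proposition2p8:
  fixes A :: "'a quandle" and B :: "'b quandle" and f :: "'a \<Rightarrow> 'b"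
  assumes "quandle A" and "quandle B"
    and "f \<in> qhom A B" and "f ` carrier A = carrier B"
  shows "class_M TYPE('x) A B f \<longleftrightarrow> Eq A f \<inter> inn_rel A = Id_on (carrier A)"
proof
  assume "class_M TYPE('x) A B f"
  then have "is_pullback TYPE('x) A f (component A) B (pi0 A) (pi0 B) (component B) (pi0_map A B f)"
    by (simp add: class_M_def)
  from pullback_legs_jointly_injective[OF this]
  show "Eq A f \<inter> inn_rel A = Id_on (carrier A)"
    by (auto simp: Eq_inter_inn_rel_iff[OF assms(1)])
next
  assume "Eq A f \<inter> inn_rel A = Id_on (carrier A)"
  then have inj: "a = a'" if "a \<in> carrier A" "a' \<in> carrier A" "f a = f a'"
    "component A a = component A a'" for a a'
    using that by (auto simp: Eq_inter_inn_rel_iff[OF assms(1)])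
  have cA: "component A \<in> qhom A (pi0 A)"
    using assms(1) by (rule quandle.component_hom)
  have lift: "\<exists>!w. w \<in> qhom X A \<inter> extensional (carrier X) \<and>
      (\<forall>x\<in>carrier X. f (w x) = u x \<and> component A (w x) = v x)"
    if X: "quandle X" and u: "u \<in> qhom X B" and v: "v \<in> qhom X (pi0 A)"
      and uv: "\<forall>x\<in>carrier X. component B (u x) = pi0_map A B f (v x)"
    for X :: "'x quandle" and u v
  proof -
    \<comment> \<open>The cone condition says that \<open>u x\<close> and \<open>v x\<close> have
      the same image in \<open>pi0 B\<close>, so a common preimage exists pointwise.\<close>
    have "\<exists>a\<in>carrier A. f a = u x \<and> component A a = v x" if "x \<in> carrier X" for x
      using component_lift[OF assms, of "u x" "v x"] qhom_closed[OF u that] qhom_closed[OF v that]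
        uv that by (simp add: pi0_def)
    then obtain w0 where w0:
      "w0 x \<in> carrier A" "f (w0 x) = u x" "component A (w0 x) = v x" if "x \<in> carrier X" for x
      by metis
    \<comment> \<open>The restriction makes the chosen map extensional, as required of a mediating
      morphism.\<close>
    define w where "w = restrict w0 (carrier X)"
    have w: "w x \<in> carrier A" "f (w x) = u x" "component A (w x) = v x" if "x \<in> carrier X" for x
      using w0[OF that] that by (simp_all add: w_def)
    \<comment> \<open>A pointwise choice is already a homomorphism: both sides have the same image
      under \<open>f\<close> and under \<open>component A\<close>, since \<open>f\<close>,
      \<open>component A\<close>, \<open>u\<close> and \<open>v\<close> preserve the operations, and
      \<open>inj\<close> then identifies them.\<close>
    have rop: "w (x \<triangleleft>\<^bsub>X\<^esub> y) = w x \<triangleleft>\<^bsub>A\<^esub> w y"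
      if "x \<in> carrier X" "y \<in> carrier X" for x y
      using that X assms(1,3) u v cA
      by (intro inj) (simp_all add: w quandle.rop_closed qhom_rop)
    have rinv: "w (x \<triangleleft>\<inverse>\<^bsub>X\<^esub> y) = w x \<triangleleft>\<inverse>\<^bsub>A\<^esub> w y"
      if "x \<in> carrier X" "y \<in> carrier X" for x y
      using that X assms(1,3) u v cA
      by (intro inj) (simp_all add: w quandle.rinv_closed qhom_rinv)
    show ?thesis
    proof (rule ex1I[of _ w])
      show "w \<in> qhom X A \<inter> extensional (carrier X) \<and>
          (\<forall>x\<in>carrier X. f (w x) = u x \<and> component A (w x) = v x)"
        using w rop rinv by (auto simp: qhom_def w_def)
    next
      fix w'
      assume w': "w' \<in> qhom X A \<inter> extensional (carrier X) \<and>
          (\<forall>x\<in>carrier X. f (w' x) = u x \<and> component A (w' x) = v x)"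
      show "w' = w"
      proof (rule extensionalityI[of _ "carrier X"])
        fix x
        assume "x \<in> carrier X"
        \<comment> \<open>Both values lie over the pair \<open>u x\<close>, \<open>v x\<close>, so
          \<open>inj\<close> applies once more.\<close>
        then show "w' x = w x"
          using w' w qhom_closed[of w' X A x] by (intro inj) auto
      qed (use w' in \<open>auto simp: w_def\<close>)
    qed
  qed
  show "class_M TYPE('x) A B f"
    unfolding class_M_def is_pullback_def
    using assms lift cA
    by (auto simp: quandle.quandle_pi0 quandle.component_hom pi0_map_hom pi0_map_component)
qed

end
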